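(* Let $s$ and $t$ be relatively prime positive integers. Then for every integer $n > s+t$, \[a_{s,t}(n) = \left( \sum_{r=0}^{s-1} a_{s,t}\!\left(n-r- \left\lceil\frac{rt+1}{s}\right\rceil \right) \right) + a_{s,t}(n-s-t).\]
   Context: A composition of a positive integer $n$ is an ordered sequence $(c_1, \ldots, c_\ell)$ of positive integers, called parts, whose sum is $n$. For positive integers $s$ and $t$, $A_{s,t}(n)$ denotes the set of compositions $(c_1,\ldots,c_\ell)$ of $n$ that satisfy $s\, c_{2i-1} > t\, c_{2i}$ for every $i \ge 1$ with $2i \le \ell$ (if the number of parts $\ell$ is odd, no condition is imposed on the last part $c_\ell$). Put $a_{s,t}(n) = |A_{s,t}(n)|$. *)

theory Defs
  imports Complex_Main
begin

definition composition :: "nat \<Rightarrow> nat list \<Rightarrow> bool" where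
  "composition n cs \<longleftrightarrow> (\<forall>c\<in>set cs. c > 0) \<and> sum_list cs = n"

(* Parts are numbered from 1, list positions from 0: the part c_j is cs ! (j - 1). *)
definition A_st :: "nat \<Rightarrow> nat \<Rightarrow> nat \<Rightarrow> nat list set" where
  "A_st s t n = {cs. composition n cs \<and>
     (\<forall>i\<ge>1. 2 * i \<le> length cs \<longrightarrow> s * cs ! (2 * i - 1 - 1) > t * cs ! (2 * i - 1))}"

definition a_st :: "nat \<Rightarrow> nat \<Rightarrow> nat \<Rightarrow> nat" where
  "a_st s t n = card (A_st s t n)"

end

theory Submission
  imports Defs
begin

text \<open>
  Let \<open>e(k)\<close> be the number of the compositions of \<open>k\<close> in question that have an even number of parts,
  so that every part is constrained by its partner. There are two ways to read a composition as one
  of even length followed by a remainder: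

  \<^item> the remainder is the unpaired last part, or \<open>0\<close> if there is none; it is an arbitrary number,
    whence \<open>a(n) = (\<Sum>k\<le>n. e(n - k))\<close>;
  \<^item> for \<open>n > 0\<close>, the remainder is the last pair \<open>(p, q)\<close>, where an unpaired last part \<open>p\<close> is the pair
    \<open>(p, 0)\<close>; then \<open>(p, q)\<close> is an arbitrary lattice point of the cone \<open>s p > t q \<ge> 0\<close>, whence \<open>a(n)\<close> is
    the sum of \<open>e(n - p - q)\<close> over the cone.

  The recurrence results from cutting the cone along the line \<open>q = s\<close>. The points with \<open>q \<ge> s\<close> form
  the translate of the whole cone by \<open>(t, s)\<close>, which lies on its boundary ray, so by the second
  reading they contribute \<open>a(n - s - t)\<close>. The points with \<open>q = r < s\<close> are the \<open>(m + k, r)\<close> with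
  \<open>k \<ge> 0\<close>, where \<open>m = \<lceil>(r t + 1) / s\<rceil>\<close> is the least \<open>p\<close> with \<open>s p > t r\<close>; as \<open>k\<close> is arbitrary, the first
  reading shows that they contribute \<open>a(n - r - m)\<close>.
\<close>

section \<open>Splitting off the last parts\<close>

definition even_A_st :: "nat \<Rightarrow> nat \<Rightarrow> nat \<Rightarrow> nat list set" where
  "even_A_st s t n = {cs \<in> A_st s t n. even (length cs)}"

lemma A_st_iff:
  "cs \<in> A_st s t n \<longleftrightarrow> composition n cs \<and>
     (\<forall>j. 2 * j + 1 < length cs \<longrightarrow> t * cs ! (2 * j + 1) < s * cs ! (2 * j))"
proof -
  have "(\<forall>i\<ge>1. 2 * i \<le> length cs \<longrightarrow> s * cs ! (2 * i - 1 - 1) > t * cs ! (2 * i - 1)) \<longleftrightarrow>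
        (\<forall>j. 2 * Suc j \<le> length cs \<longrightarrow> s * cs ! (2 * Suc j - 1 - 1) > t * cs ! (2 * Suc j - 1))"
    by (metis Suc_le_D One_nat_def le_add1 plus_1_eq_Suc)
  then show ?thesis
    unfolding A_st_def by (simp add: Suc_le_eq)
qed

lemma finite_A_st: "finite (A_st s t n)"
proof (rule finite_subset)
  have "length cs \<le> sum_list cs" if "\<forall>c\<in>set cs. c > 0" for cs :: "nat list"
    using that by (induction cs) (auto simp: Suc_le_eq)
  then show "A_st s t n \<subseteq> {cs. set cs \<subseteq> {..n} \<and> length cs \<le> n}"
    using member_le_sum_list by (fastforce simp: A_st_def composition_def)
  show "finite {cs. set cs \<subseteq> {..n} \<and> length cs \<le> n}"
    by (simp add: finite_lists_length_le)
qed

lemma finite_even_A_st: "finite (even_A_st s t n)"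
  unfolding even_A_st_def using finite_A_st by simp

lemma append_part_in_A_st_iff:
  assumes "even (length cs)"
  shows "cs @ [p] \<in> A_st s t n \<longleftrightarrow> 0 < p \<and> p \<le> n \<and> cs \<in> even_A_st s t (n - p)"
proof -
  have "2 * j + 1 < length (cs @ [p]) \<longleftrightarrow> 2 * j + 1 < length cs" for j
    using assms by auto
  then have "(\<forall>j. 2 * j + 1 < length (cs @ [p]) \<longrightarrow>
                t * (cs @ [p]) ! (2 * j + 1) < s * (cs @ [p]) ! (2 * j)) \<longleftrightarrow>
             (\<forall>j. 2 * j + 1 < length cs \<longrightarrow> t * cs ! (2 * j + 1) < s * cs ! (2 * j))"
    by (simp add: nth_append)
  then show ?thesis
    using assms by (auto simp: even_A_st_def A_st_iff composition_def)
qed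

lemma append_pair_in_A_st_iff:
  assumes "even (length cs)"
  shows "cs @ [p, q] \<in> A_st s t n \<longleftrightarrow>
    0 < q \<and> t * q < s * p \<and> p + q \<le> n \<and> cs \<in> even_A_st s t (n - p - q)"
proof -
  from assms obtain k where k: "length cs = 2 * k" by blast
  have less_iff: "2 * j + 1 < length (cs @ [p, q]) \<longleftrightarrow> 2 * j + 1 < length cs \<or> j = k" for j
    using k by auto
  have "(\<forall>j. 2 * j + 1 < length (cs @ [p, q]) \<longrightarrow>
                t * (cs @ [p, q]) ! (2 * j + 1) < s * (cs @ [p, q]) ! (2 * j)) \<longleftrightarrow>
        (\<forall>j. 2 * j + 1 < length cs \<longrightarrow> t * cs ! (2 * j + 1) < s * cs ! (2 * j)) \<and> t * q < s * p"
    unfolding less_iff using k by (auto simp: nth_append)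
  moreover have "0 < p" if "t * q < s * p"
    using that by (cases p) auto
  ultimately show ?thesis
    using assms by (auto simp: even_A_st_def A_st_iff composition_def)
qed

text \<open>
  The unpaired last part, if there is one, is subject to no condition, so the remainder \<open>k\<close> takes every
  value, with \<open>k = 0\<close> accounting for the compositions of even length.
\<close>

lemma a_st_eq_sum_over_unpaired_part:
  "a_st s t n = (\<Sum>k\<le>n. card (even_A_st s t (n - k)))"
proof -
  define f :: "nat \<times> nat list \<Rightarrow> nat list"
    where "f = (\<lambda>(k, cs). if k = 0 then cs else cs @ [k])"
  define D where "D = (SIGMA k:{..n}. even_A_st s t (n - k))"
  have even_length: "even (length cs)" if "(k, cs) \<in> D" for k cs
    using that by (auto simp: D_def even_A_st_def)
  have "inj_on f D"
    by (rule inj_onI) (auto simp: f_def split: if_splits dest!: even_length)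
  moreover have "f ` D = A_st s t n"
  proof (intro equalityI subsetI)
    fix cs assume "cs \<in> f ` D"
    then obtain k ds where D: "(k, ds) \<in> D" and ds: "cs = f (k, ds)" by auto
    show "cs \<in> A_st s t n"
    proof (cases "k = 0")
      case True
      with D ds show ?thesis by (simp add: f_def D_def even_A_st_def)
    next
      case False
      with D ds show ?thesis
        using append_part_in_A_st_iff[OF even_length[OF D]] by (simp add: f_def D_def)
    qed
  next
    fix cs assume cs: "cs \<in> A_st s t n"
    show "cs \<in> f ` D"
    proof (cases "even (length cs)")
      case True
      with cs have "(0, cs) \<in> D" by (simp add: D_def even_A_st_def)
      then show ?thesis by (force simp: f_def)
    next
      case False
      then obtain ds k where ds: "cs = ds @ [k]" by (cases cs rule: rev_cases) auto
      with False cs have "0 < k" "(k, ds) \<in> D"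
        using append_part_in_A_st_iff[of ds k] by (auto simp: D_def)
      then show ?thesis using ds by (force simp: f_def)
    qed
  qed
  ultimately have "card (A_st s t n) = card D"
    using card_image by metis
  then show ?thesis
    by (simp add: a_st_def D_def finite_even_A_st)
qed

text \<open>
  The summation set is truncated at \<open>p + q \<le> n\<close> because \<open>n - p - q\<close> would otherwise be \<open>0\<close>, and the
  empty composition would be counted for every further point of the cone.
\<close>

definition cone_upto :: "nat \<Rightarrow> nat \<Rightarrow> nat \<Rightarrow> (nat \<times> nat) set" where
  "cone_upto s t n = {(p, q). t * q < s * p \<and> p + q \<le> n}"

lemma finite_cone_upto: "finite (cone_upto s t n)"
  by (rule finite_subset[of _ "{..n} \<times> {..n}"]) (auto simp: cone_upto_def)

text \<open>
  A nonempty composition has a last pair once an unpaired last part \<open>p\<close> is read as \<open>(p, 0)\<close>. This adds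
  to the admissible pairs precisely the boundary points \<open>q = 0\<close>, \<open>p > 0\<close> of the cone. For \<open>n = 0\<close> the
  equation fails, since the empty composition has no last pair.
\<close>

lemma a_st_eq_sum_over_cone:
  assumes "0 < s" and "0 < n"
  shows "a_st s t n = (\<Sum>(p, q)\<in>cone_upto s t n. card (even_A_st s t (n - p - q)))"
proof -
  define f :: "(nat \<times> nat) \<times> nat list \<Rightarrow> nat list"
    where "f = (\<lambda>((p, q), cs). if q = 0 then cs @ [p] else cs @ [p, q])"
  define D where "D = (SIGMA (p, q):cone_upto s t n. even_A_st s t (n - p - q))"
  have D_iff: "((p, q), cs) \<in> D \<longleftrightarrow>
      t * q < s * p \<and> p + q \<le> n \<and> cs \<in> even_A_st s t (n - p - q)" for p q cs
    by (auto simp: D_def cone_upto_def)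
  have even_length: "even (length cs)" if "((p, q), cs) \<in> D" for p q cs
    using that by (auto simp: D_iff even_A_st_def)
  have "inj_on f D"
  proof (rule inj_onI)
    fix x y assume "x \<in> D" "y \<in> D" "f x = f y"
    moreover obtain p q cs p' q' cs' where xy: "x = ((p, q), cs)" "y = ((p', q'), cs')"
      by (metis surj_pair)
    ultimately have ev: "even (length cs)" "even (length cs')" and "f x = f y"
      using even_length by auto
    \<comment> \<open>The parity of the length tells an unpaired last part from a last pair.\<close>
    moreover from this have "even (length (f x)) = even (length (f y))" by simp
    ultimately show "x = y"
      by (auto simp: f_def xy split: if_splits)
  qed
  moreover have "f ` D = A_st s t n"
  proof (intro equalityI subsetI)
    fix cs assume "cs \<in> f ` D"
    then obtain p q ds where D: "((p, q), ds) \<in> D" and cs: "cs = f ((p, q), ds)" by auto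
    from D have "0 < p" by (cases p) (auto simp: D_iff)
    with D cs show "cs \<in> A_st s t n"
      using even_length[OF D] append_part_in_A_st_iff[of ds p] append_pair_in_A_st_iff[of ds p q]
      by (auto simp: f_def D_iff)
  next
    fix cs assume cs: "cs \<in> A_st s t n"
    then have "cs \<noteq> []"
      using \<open>0 < n\<close> by (auto simp: A_st_def composition_def)
    then obtain es q where es: "cs = es @ [q]" by (cases cs rule: rev_cases) auto
    show "cs \<in> f ` D"
    proof (cases "even (length es)")
      case True
      with cs es \<open>0 < s\<close> have "((q, 0), es) \<in> D"
        using append_part_in_A_st_iff[of es q] by (auto simp: D_iff)
      then show ?thesis using es by (force simp: f_def)
    next
      case False
      then obtain ds p where ds: "es = ds @ [p]" by (cases es rule: rev_cases) auto
      with False cs es have "0 < q" "((p, q), ds) \<in> D"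
        using append_pair_in_A_st_iff[of ds p q] by (auto simp: D_iff)
      then show ?thesis using es ds by (force simp: f_def)
    qed
  qed
  ultimately have "card (A_st s t n) = card D"
    using card_image by metis
  also have "\<dots> = (\<Sum>x\<in>cone_upto s t n. card (case x of (p, q) \<Rightarrow> even_A_st s t (n - p - q)))"
    unfolding D_def by (rule card_SigmaI) (auto simp: finite_cone_upto finite_even_A_st)
  finally show ?thesis
    by (simp add: a_st_def case_prod_unfold)
qed

section \<open>Cutting the cone\<close>

text \<open>
  On the ray \<open>s p = t q\<close> through \<open>(t, s)\<close> the defining form \<open>s p - t q\<close> vanishes, so translation
  by \<open>(t, s)\<close> preserves the inequality of the cone.
\<close>

lemma cone_upto_above:
  assumes "s + t \<le> n"
  shows "{(p, q) \<in> cone_upto s t n. s \<le> q} = (\<lambda>(p, q). (p + t, q + s)) ` cone_upto s t (n - s - t)"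
proof (intro equalityI subsetI)
  fix x assume "x \<in> {(p, q) \<in> cone_upto s t n. s \<le> q}"
  then obtain p q where x: "x = (p, q)" and pq: "t * q < s * p" "p + q \<le> n" "s \<le> q"
    by (auto simp: cone_upto_def)
  have "s * t \<le> t * q" using pq(3) by (simp add: mult.commute)
  then have "s * t < s * p" using pq(1) by linarith
  then have "t < p" by simp
  then obtain p' q' where "p = p' + t" "q = q' + s"
    using pq(3) by (metis le_add_diff_inverse2 less_imp_le)
  then have "(p', q') \<in> cone_upto s t (n - s - t)" "x = (p' + t, q' + s)"
    using x pq by (auto simp: cone_upto_def algebra_simps)
  then show "x \<in> (\<lambda>(p, q). (p + t, q + s)) ` cone_upto s t (n - s - t)"
    by force
next
  fix x assume "x \<in> (\<lambda>(p, q). (p + t, q + s)) ` cone_upto s t (n - s - t)"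
  then show "x \<in> {(p, q) \<in> cone_upto s t n. s \<le> q}"
    using assms by (auto simp: cone_upto_def algebra_simps)
qed

lemma less_mult_iff_div:
  fixes s t p q :: nat
  assumes "0 < s"
  shows "t * q < s * p \<longleftrightarrow> q * t div s + 1 \<le> p"
  using div_less_iff_less_mult[OF assms, of "q * t" p] by (simp add: mult.commute Suc_le_eq)

lemma ceiling_Suc_divide:
  fixes m s :: nat
  assumes "0 < s"
  shows "\<lceil>(real m + 1) / real s\<rceil> = int (m div s + 1)"
proof (rule ceiling_unique)
  have "m div s * s \<le> m" "m < (m div s + 1) * s"
    using assms by (simp_all add: dividend_less_div_times add.commute)
  then have "real (m div s) * real s \<le> real m" "real m + 1 \<le> (real (m div s) + 1) * real s"
    by (metis of_nat_le_iff of_nat_mult,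
        metis Suc_leI of_nat_1 of_nat_Suc of_nat_add of_nat_le_iff of_nat_mult add.commute)
  then show "real_of_int (int (m div s + 1)) - 1 < (real m + 1) / real s"
    and "(real m + 1) / real s \<le> real_of_int (int (m div s + 1))"
    using assms by (simp_all add: field_simps)
qed

theorem corollary2:
  fixes s t n :: nat
  assumes "s > 0" and "t > 0" and "coprime s t" and "n > s + t"
  shows "a_st s t n =
    (\<Sum>r=0..s-1. a_st s t (nat (int n - int r - \<lceil>(real r * real t + 1) / real s\<rceil>)))
      + a_st s t (n - s - t)"
proof -
  define e where "e k = card (even_A_st s t k)" for k
  define g where "g = (\<lambda>(p, q). e (n - p - q))"
  define least where "least r = r * t div s + 1" for r
  \<comment> \<open>The arguments on the right-hand side are therefore not truncated at \<open>0\<close>, which would count the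
    empty composition for a row \<open>q = r\<close> without points.\<close>
  have least_le: "r + least r \<le> n" if "r < s" for r
  proof -
    have "r * t < t * s" using that \<open>t > 0\<close> by (simp add: mult.commute)
    then have "r * t div s < t" using \<open>s > 0\<close> by (simp add: div_less_iff_less_mult)
    with that \<open>n > s + t\<close> show ?thesis by (simp add: least_def)
  qed
  have low: "(\<Sum>x | x \<in> cone_upto s t n \<and> snd x < s. g x) = (\<Sum>r<s. a_st s t (n - r - least r))"
  proof -
    have "(\<Sum>r<s. a_st s t (n - r - least r)) = (\<Sum>r<s. \<Sum>k\<le>n - r - least r. e (n - r - least r - k))"
      by (simp add: a_st_eq_sum_over_unpaired_part e_def)
    also have "\<dots> = (\<Sum>(r, k)\<in>(SIGMA r:{..<s}. {..n - r - least r}). e (n - r - least r - k))"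
      by (rule sum.Sigma) auto
    also have "\<dots> = (\<Sum>x | x \<in> cone_upto s t n \<and> snd x < s. g x)"
    proof (rule sum.reindex_bij_witness[where i = "\<lambda>(p, r). (r, p - least r)"
          and j = "\<lambda>(r, k). (least r + k, r)"])
      fix x assume "x \<in> {x. x \<in> cone_upto s t n \<and> snd x < s}"
      then obtain p r where x: "x = (p, r)" and pr: "least r \<le> p" "p + r \<le> n" "r < s"
        using less_mult_iff_div[OF \<open>s > 0\<close>] by (auto simp: cone_upto_def least_def)
      show "(case case x of (p, r) \<Rightarrow> (r, p - least r) of (r, k) \<Rightarrow> (least r + k, r)) = x"
        and "(case x of (p, r) \<Rightarrow> (r, p - least r)) \<in> (SIGMA r:{..<s}. {..n - r - least r})"
        using x pr by auto
    next
      fix y assume "y \<in> (SIGMA r:{..<s}. {..n - r - least r})"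
      then obtain r k where y: "y = (r, k)" and rk: "r < s" "k \<le> n - r - least r"
        by auto
      have "least r + k + r \<le> n" using rk least_le[of r] by linarith
      moreover have "t * r < s * (least r + k)"
        using less_mult_iff_div[OF \<open>s > 0\<close>, of t r "least r + k"] by (simp add: least_def)
      ultimately show "(case y of (r, k) \<Rightarrow> (least r + k, r)) \<in> {x. x \<in> cone_upto s t n \<and> snd x < s}"
        using y rk by (simp add: cone_upto_def)
      show "(case case y of (r, k) \<Rightarrow> (least r + k, r) of (p, r) \<Rightarrow> (r, p - least r)) = y"
        using y by simp
      show "g (case y of (r, k) \<Rightarrow> (least r + k, r)) = (case y of (r, k) \<Rightarrow> e (n - r - least r - k))"
        using y by (simp add: g_def algebra_simps)
    qed
    finally show ?thesis by simp
  qed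
  have high: "(\<Sum>x | x \<in> cone_upto s t n \<and> s \<le> snd x. g x) = a_st s t (n - s - t)"
  proof -
    have set_eq: "{x. x \<in> cone_upto s t n \<and> s \<le> snd x} =
        (\<lambda>(p, q). (p + t, q + s)) ` cone_upto s t (n - s - t)"
      using cone_upto_above[of s t n] \<open>n > s + t\<close> by (simp add: case_prod_unfold)
    have "inj_on (\<lambda>(p, q). (p + t, q + s)) (cone_upto s t (n - s - t))"
      by (auto simp: inj_on_def)
    then have "(\<Sum>x | x \<in> cone_upto s t n \<and> s \<le> snd x. g x) =
        (\<Sum>(p, q)\<in>cone_upto s t (n - s - t). e (n - s - t - p - q))"
      unfolding set_eq by (simp add: sum.reindex g_def case_prod_unfold o_def algebra_simps)
    \<comment> \<open>Here \<open>n > s + t\<close> must be strict: there is no reading by last pairs for \<open>n - s - t = 0\<close>.\<close>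
    also have "\<dots> = a_st s t (n - s - t)"
      using a_st_eq_sum_over_cone[of s "n - s - t" t] \<open>s > 0\<close> \<open>n > s + t\<close> by (simp add: e_def)
    finally show ?thesis .
  qed
  have "a_st s t n = (\<Sum>x\<in>cone_upto s t n. g x)"
    using a_st_eq_sum_over_cone[of s n t] assms by (simp add: g_def e_def)
  also have "\<dots> = (\<Sum>x | x \<in> cone_upto s t n \<and> snd x < s. g x)
      + (\<Sum>x | x \<in> cone_upto s t n \<and> s \<le> snd x. g x)"
    by (subst sum.union_disjoint[symmetric])
       (auto simp: finite_cone_upto intro!: sum.cong)
  also have "\<dots> = (\<Sum>r<s. a_st s t (n - r - least r)) + a_st s t (n - s - t)"
    by (simp add: low high)
  also have "(\<Sum>r<s. a_st s t (n - r - least r)) =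
      (\<Sum>r=0..s-1. a_st s t (nat (int n - int r - \<lceil>(real r * real t + 1) / real s\<rceil>)))"
  proof (rule sum.cong)
    show "{..<s} = {0..s-1}" using \<open>s > 0\<close> by auto
  next
    fix r
    have "\<lceil>(real r * real t + 1) / real s\<rceil> = int (least r)"
      using ceiling_Suc_divide[OF \<open>s > 0\<close>, of "r * t"] by (simp add: least_def)
    then have "nat (int n - int r - \<lceil>(real r * real t + 1) / real s\<rceil>) = n - r - least r"
      by linarith
    then show "a_st s t (n - r - least r) =
        a_st s t (nat (int n - int r - \<lceil>(real r * real t + 1) / real s\<rceil>))" by simp
  qed
  finally show ?thesis .
qed

end
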